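(* For the SQG-estimates $z^t$ of $g(x)$ with $\rho_t=\rho/(1+t)^p$, $\theta_t=\theta/(1+t)^q$, the maximal rate of convergence $1/(1+t)^{\gamma^*}$, $\gamma^*=\nu/(r+\nu)$, of the SQG-estimates is achieved at $p^*=1$ and $q^*=1/(r+\nu)$. For example, in the case $\nu=r=1$ the maximal rate is proportional to $1/(1+t)^{1/2}$.
   Context: $X\subseteq\mathbb{R}^r$; $G$ is the class of functions $g$ on $X$ with $0\le\underline g(x)\le g(x)\le\overline g(x)\le\overline g$ for all $x\in X$ ($\underline g(\cdot),\overline g(\cdot)$ given functions, $\overline g$ a finite constant). $g\in G$ is a probability density on $X$, globally Hölder continuous at the point $x\in X$: $|g(x)-g(y)|\le H\|x-y\|^{\nu}$ for all $y\in X$, with $\nu>0$. The kernel $K\ge0$ is a bounded Borel density with $\int_XK(y)\,dy=1$, $\sup_{y\in X}K(y)\le\overline K$ and $A=\int_{\mathbb{R}^r}\|y\|^{\nu}K(y)\,dy<\infty$. Observations $\overline x_0,\overline x_1,\dots$ are i.i.d. with density $g$. SQG-estimates: $z^0\in[\underline g(x),\overline g(x)]$, $z^{t+1}=\min\{\overline g(x),\max\{\underline g(x),z^t-\rho_t\xi_t\}\}$, $\xi_t=z^t-\theta_t^{-r}K((\overline x_t-x)/\theta_t)$, $t=0,1,\dots$, with $\theta>0$, $q\ge0$, $0<p\le1$, $p<\rho$. The rate of convergence is that of the mean square error $\mathbf{E}|z^t-g(x)|^2$. The statement is a corollary of the estimate that, for these parameters and all $t\ge0$, $\mathbf{E}|z^t-g(x)|^2\le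 Q/(1+t)^{\gamma}$ with $\gamma=\min\{\nu q,p,p-rq\}$, $Q=\max\{|z^0-g(x)|^2,\,C/(2\rho-p)\}$ and $C=\max\{4AH\overline g\rho\theta^{\nu},2\overline g^2\rho^2,2\overline K\,\overline g\rho^2\theta^{-r}\}$.
   Formalization: Added assumption: for all s in (0,θ], the rescaled kernel s^{-r}K((u-x)/s) has integral 1 over X (automatic for X=R^r). Without it the claim fails: X=[0,1], g=1, K=1_[0,1], x=1, lower bound 0. Interior x reduces to X=R^r by extending g by 0. *)

theory Defs
  imports "HOL-Probability.Probability" "HOL-Library.Landau_Symbols"
begin

definition density_class ::
  "'a set \<Rightarrow> ('a \<Rightarrow> real) \<Rightarrow> ('a \<Rightarrow> real) \<Rightarrow> real \<Rightarrow> ('a \<Rightarrow> real) set" where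
  "density_class X glo ghi gbar =
     {g. \<forall>y\<in>X. 0 \<le> glo y \<and> glo y \<le> g y \<and> g y \<le> ghi y \<and> ghi y \<le> gbar}"

definition stepsize :: "real \<Rightarrow> real \<Rightarrow> nat \<Rightarrow> real" where
  "stepsize \<rho> p t = \<rho> / (1 + real t) powr p"

definition bandwidth :: "real \<Rightarrow> real \<Rightarrow> nat \<Rightarrow> real" where
  "bandwidth \<theta> q t = \<theta> / (1 + real t) powr q"

definition scaled_kernel ::
  "(real ^ 'n \<Rightarrow> real) \<Rightarrow> real ^ 'n \<Rightarrow> real \<Rightarrow> real ^ 'n \<Rightarrow> real" where
  "scaled_kernel K x s u = K ((u - x) /\<^sub>R s) / s ^ CARD('n)"

text \<open>The interval bounds \<open>lo\<close>, \<open>hi\<close> are the values of the lower and upper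
  envelope at the estimation point \<open>x\<close>; \<open>obs t w\<close> is the observation at time \<open>t\<close>.\<close>

primrec sqg ::
  "real \<Rightarrow> real \<Rightarrow> (real ^ 'n \<Rightarrow> real) \<Rightarrow> real ^ 'n \<Rightarrow> (nat \<Rightarrow> real) \<Rightarrow> (nat \<Rightarrow> real) \<Rightarrow>
   (nat \<Rightarrow> 'b \<Rightarrow> real ^ 'n) \<Rightarrow> real \<Rightarrow> nat \<Rightarrow> 'b \<Rightarrow> real" where
  "sqg lo hi K x rho theta obs z0 0 w = z0"
| "sqg lo hi K x rho theta obs z0 (Suc t) w =
     (let z = sqg lo hi K x rho theta obs z0 t w;
          \<xi> = z - scaled_kernel K x (theta t) (obs t w)
      in min hi (max lo (z - rho t * \<xi>)))"

locale sqg_problem = prob_space M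
  for M :: "'b measure" +
  fixes X :: "(real ^ 'n) set"
    and glo ghi :: "real ^ 'n \<Rightarrow> real" and gbar :: real
    and g :: "real ^ 'n \<Rightarrow> real"
    and x :: "real ^ 'n" and H \<nu> :: real
    and K :: "real ^ 'n \<Rightarrow> real" and Kbar :: real
    and obs :: "nat \<Rightarrow> 'b \<Rightarrow> real ^ 'n"
    and z0 \<theta> :: real
  assumes X_borel: "X \<in> sets borel"
    and x_in_X: "x \<in> X"
    and g_class: "g \<in> density_class X glo ghi gbar"
    and g_measurable: "set_borel_measurable borel X g"
    and g_density: "(LINT y:X|lborel. g y) = 1"
    and holder_exponent: "0 < \<nu>"
    and g_holder: "\<And>y. y \<in> X \<Longrightarrow> \<bar>g x - g y\<bar> \<le> H * norm (x - y) powr \<nu>"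
    and K_borel: "K \<in> borel_measurable borel"
    and K_nonneg: "\<And>y. 0 \<le> K y"
    and K_density: "(LINT y|lborel. K y) = 1"
    and K_density_X: "(LINT y:X|lborel. K y) = 1"
    and K_bounded: "\<And>y. y \<in> X \<Longrightarrow> K y \<le> Kbar"
    and K_moment: "integrable lborel (\<lambda>y. norm y powr \<nu> * K y)"
    and obs_indep: "indep_vars (\<lambda>_. borel) obs UNIV"
    and obs_density: "\<And>t. distributed M lborel (obs t) (\<lambda>y. ennreal (indicator X y * g y))"
    and z0_range: "z0 \<in> {glo x..ghi x}"
    and theta_pos: "0 < \<theta>"
    \<comment> \<open>The kernel rescaled around \<open>x\<close> loses no mass outside \<open>X\<close>. For \<open>X = UNIV\<close> this
        follows from \<open>K_density\<close>; for other \<open>X\<close> it can fail, e.g. at a boundary point, and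
        then the kernel estimate need not be consistent. All bandwidths lie in \<open>{0<..\<theta>}\<close>.\<close>
    and window: "\<And>s. s \<in> {0<..\<theta>} \<Longrightarrow> (LINT u:X|lborel. scaled_kernel K x s u) = 1"

definition sqg_mse ::
  "'b measure \<Rightarrow> (real ^ 'n \<Rightarrow> real) \<Rightarrow> (real ^ 'n \<Rightarrow> real) \<Rightarrow> (real ^ 'n \<Rightarrow> real) \<Rightarrow> real ^ 'n \<Rightarrow>
   (real ^ 'n \<Rightarrow> real) \<Rightarrow> (nat \<Rightarrow> 'b \<Rightarrow> real ^ 'n) \<Rightarrow> real \<Rightarrow> real \<Rightarrow> real \<Rightarrow> real \<Rightarrow> real \<Rightarrow> nat \<Rightarrow> real"
  where
  "sqg_mse M glo ghi g x K obs z0 \<theta> \<rho> p q t =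
     (LINT w|M. \<bar>sqg (glo x) (ghi x) K x (stepsize \<rho> p) (bandwidth \<theta> q) obs z0 t w - g x\<bar>\<^sup>2)"

definition admissible :: "real \<Rightarrow> real \<Rightarrow> real \<Rightarrow> bool" where
  "admissible \<rho> p q \<longleftrightarrow> 0 \<le> q \<and> 0 < p \<and> p \<le> 1 \<and> p < \<rho>"

text \<open>The exponent of the mean square error estimate: \<open>\<nu> * q\<close> stems from the bias of the
  kernel, \<open>p\<close> and \<open>p - r * q\<close> from the second moment of the stochastic gradient.\<close>

definition rate_exponent :: "nat \<Rightarrow> real \<Rightarrow> real \<Rightarrow> real \<Rightarrow> real" where
  "rate_exponent r \<nu> p q = min (\<nu> * q) (min p (p - real r * q))"

end

theory Submission
  imports Defs
begin

text \<open>The projection onto the envelope interval does not increase the distance to \<open>g x\<close>, and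
  the estimate \<open>z t\<close> depends only on the observations before time \<open>t\<close>, hence is independent
  of the kernel value at time \<open>t\<close>. Expanding the square therefore bounds the mean square error
  at time \<open>t + 1\<close> by \<open>(1 - 2 * \<rho> t)\<close> times that at time \<open>t\<close>, plus a bias term of order
  \<open>\<rho> t * \<theta> t powr \<nu>\<close> and a second moment term of order \<open>(\<rho> t)\<^sup>2 / \<theta> t ^ r\<close>.
  A Chung type lemma turns this into the power rate, whose exponent is then maximised.\<close>

section \<open>Affine substitution in Euclidean space\<close>

text \<open>\<open>lborel\<close> is its own image under the affine map, weighted by the constant
  Jacobian. A nonzero constant weight does not affect integrability.\<close>

lemma integrable_lborel_affine_iff:
  fixes f :: "'a::euclidean_space \<Rightarrow> real"
  assumes "c \<noteq> 0" and [measurable]: "f \<in> borel_measurable borel"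
  shows "integrable lborel (\<lambda>u. f (t + c *\<^sub>R u)) \<longleftrightarrow> integrable lborel f"
proof -
  have "integrable lborel f \<longleftrightarrow>
      integrable (density (distr lborel borel (\<lambda>u. t + c *\<^sub>R u)) (\<lambda>_. ennreal (\<bar>c\<bar> ^ DIM('a)))) f"
    using lborel_affine[OF assms(1), of t] by (simp add: ennreal_power)
  also have "\<dots> \<longleftrightarrow> integrable lborel (\<lambda>u. f (t + c *\<^sub>R u))"
    using assms(1) by (subst integrable_density) (simp_all add: integrable_distr_eq)
  finally show ?thesis by simp
qed

lemma integral_lborel_affine:
  fixes f :: "'a::euclidean_space \<Rightarrow> real"
  assumes "c \<noteq> 0" and [measurable]: "f \<in> borel_measurable borel"
  shows "(LINT u|lborel. f (t + c *\<^sub>R u)) = (LINT u|lborel. f u) / \<bar>c\<bar> ^ DIM('a)"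
proof -
  have "(LINT u|lborel. f u) =
      (LINT u|density (distr lborel borel (\<lambda>u. t + c *\<^sub>R u)) (\<lambda>_. ennreal (\<bar>c\<bar> ^ DIM('a))). f u)"
    using lborel_affine[OF assms(1), of t] by (simp add: ennreal_power)
  also have "\<dots> = \<bar>c\<bar> ^ DIM('a) * (LINT u|lborel. f (t + c *\<^sub>R u))"
    by (subst integral_density) (simp_all add: integral_distr)
  finally show ?thesis using assms(1) by (simp add: field_simps)
qed

text \<open>The Jacobian is a positive constant, so an affine change of variables preserves null
  sets. This carries the almost everywhere bound on \<open>K\<close> over to the rescaled
  kernels.\<close>

lemma AE_lborel_affine:
  fixes P :: "'a::euclidean_space \<Rightarrow> bool"
  assumes "c \<noteq> 0" and [measurable]: "Measurable.pred borel P" and "AE y in lborel. P y"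
  shows "AE u in lborel. P (t + c *\<^sub>R u)"
proof -
  have "AE y in density (distr lborel borel (\<lambda>u. t + c *\<^sub>R u)) (\<lambda>_. ennreal (\<bar>c\<bar> ^ DIM('a))). P y"
    using assms(3) by (subst (asm) lborel_affine[OF assms(1), of t]) (simp add: ennreal_power)
  then have "AE y in distr lborel borel (\<lambda>u. t + c *\<^sub>R u). P y"
    using assms(1) by (subst (asm) AE_density) simp_all
  then show ?thesis
    by (subst (asm) AE_distr_iff) simp_all
qed

section \<open>A recursive inequality\<close>

text \<open>Bernoulli's inequality for a negative exponent: \<open>exp y \<ge> 1 + y\<close> at
  \<open>y = - \<gamma> * ln (1 + 1 / n)\<close>, together with
  \<open>ln (1 + 1 / n) \<le> 1 / n\<close>.\<close>

lemma inverse_powr_step: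
  fixes n \<gamma> :: real
  assumes "0 < n" "0 \<le> \<gamma>"
  shows "n powr - \<gamma> * (1 - \<gamma> / n) \<le> (n + 1) powr - \<gamma>"
proof -
  have "ln (1 + 1 / n) \<le> 1 / n"
    using assms by (intro ln_add_one_self_le_self) simp
  then have "1 - \<gamma> / n \<le> 1 + (- \<gamma> * ln (1 + 1 / n))"
    using mult_left_mono[of "ln (1 + 1 / n)" "1 / n" \<gamma>] assms by simp
  also have "\<dots> \<le> exp (- \<gamma> * ln (1 + 1 / n))"
    by (rule exp_ge_add_one_self)
  also have "\<dots> = (1 + 1 / n) powr - \<gamma>"
    using assms by (simp add: powr_def add_pos_pos less_imp_neq[symmetric] add_nonneg_eq_0_iff)
  finally have "n powr - \<gamma> * (1 - \<gamma> / n) \<le> n powr - \<gamma> * (1 + 1 / n) powr - \<gamma>"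
    by (intro mult_left_mono) simp_all
  also have "\<dots> = (n * (1 + 1 / n)) powr - \<gamma>"
    using assms by (simp add: powr_mult)
  also have "n * (1 + 1 / n) = n + 1"
    using assms by (simp add: field_simps)
  finally show ?thesis .
qed

text \<open>Inserting the induction hypothesis, with \<open>n = 1 + t\<close>, leaves at most
  \<open>Q * n powr - \<gamma> * (1 - \<gamma> * n powr - p)\<close>. As \<open>p \<le> 1\<close>,
  the contraction is at least the \<open>\<gamma> / n\<close> that passing from \<open>n\<close> to
  \<open>n + 1\<close> costs.\<close>

lemma chung_recursion:
  fixes u :: "nat \<Rightarrow> real"
  assumes nonneg: "\<And>t. 0 \<le> u t" and "0 \<le> D"
    and p: "0 < p" "p \<le> 1" and \<gamma>: "0 \<le> \<gamma>" "\<gamma> < 2 * \<rho>"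
    and step: "\<And>t. u (Suc t) \<le> (1 - 2 * (\<rho> / (1 + real t) powr p)) * u t
                  + D * (1 + real t) powr (- p - \<gamma>)"
  shows "\<exists>Q. \<forall>t. u t \<le> Q * (1 + real t) powr - \<gamma>"
proof -
  \<comment> \<open>The three entries serve the start of the induction, the steps with a negative
    contraction factor and the steps with a nonnegative one, in this order.\<close>
  define Q where "Q = max (u 0) (max (D * 2 powr \<gamma>) (D / (2 * \<rho> - \<gamma>)))"
  have Q: "u 0 \<le> Q" "D * 2 powr \<gamma> \<le> Q" "D / (2 * \<rho> - \<gamma>) \<le> Q"
    by (simp_all add: Q_def)
  have "0 \<le> Q" using Q(1) nonneg[of 0] by simp
  have D: "D \<le> Q * (2 * \<rho> - \<gamma>)"
    using Q(3) \<gamma> by (simp add: pos_divide_le_eq)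
  have "u t \<le> Q * (1 + real t) powr - \<gamma>" for t
  proof (induction t)
    case 0
    show ?case using Q(1) by simp
  next
    case (Suc t)
    define n where "n = 1 + real t"
    have n: "1 \<le> n" by (simp add: n_def)
    have split: "n powr (- p - \<gamma>) = n powr - \<gamma> * n powr - p"
      using powr_add[of n "- p" "- \<gamma>"] by (simp add: mult.commute)
    have step': "u (Suc t) \<le> (1 - 2 * \<rho> * n powr - p) * u t + D * n powr (- p - \<gamma>)"
      using step[of t] by (simp add: n_def powr_minus divide_inverse mult.assoc)
    have "u (Suc t) \<le> Q * (n + 1) powr - \<gamma>"
    \<comment> \<open>For large \<open>\<rho>\<close> the factor is negative at early times, and the
      induction hypothesis cannot be multiplied by it. The term with \<open>u t\<close> is then at
      most 0 and is dropped.\<close>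
    proof (cases "0 \<le> 1 - 2 * \<rho> * n powr - p")
      case True
      have "u (Suc t) \<le> (1 - 2 * \<rho> * n powr - p) * (Q * n powr - \<gamma>) + D * n powr (- p - \<gamma>)"
        using step' mult_left_mono[OF Suc.IH True] by (simp add: n_def)
      also have "\<dots> \<le> (1 - 2 * \<rho> * n powr - p) * (Q * n powr - \<gamma>)
          + (Q * (2 * \<rho> - \<gamma>)) * n powr (- p - \<gamma>)"
        using mult_right_mono[OF D, of "n powr (- p - \<gamma>)"] by simp
      also have "\<dots> = Q * (n powr - \<gamma> * (1 - \<gamma> * n powr - p))"
        unfolding split by (simp add: algebra_simps)
      also have "\<dots> \<le> Q * (n powr - \<gamma> * (1 - \<gamma> / n))"
      proof -
        have "n powr - 1 \<le> n powr - p"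
          using n p by (intro powr_mono) simp_all
        then have "\<gamma> / n \<le> \<gamma> * n powr - p"
          using mult_left_mono[of "n powr - 1" "n powr - p" \<gamma>] \<gamma> n
          by (simp add: powr_minus divide_inverse)
        then show ?thesis
          using \<open>0 \<le> Q\<close> by (intro mult_left_mono) simp_all
      qed
      also have "\<dots> \<le> Q * (n + 1) powr - \<gamma>"
        using inverse_powr_step[of n \<gamma>] n \<gamma> \<open>0 \<le> Q\<close> by (intro mult_left_mono) simp_all
      finally show ?thesis .
    next
      case False
      have "u (Suc t) \<le> D * n powr (- p - \<gamma>)"
        using step' nonneg[of t] False mult_nonpos_nonneg[of "1 - 2 * \<rho> * n powr - p" "u t"]
        by linarith
      also have "\<dots> \<le> D * n powr - \<gamma>"
        using n p \<open>0 \<le> D\<close> by (intro mult_left_mono powr_mono) simp_all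
      \<comment> \<open>The factor \<open>2 powr \<gamma>\<close> pays for replacing
        \<open>n\<close> by \<open>n + 1\<close>, since \<open>n + 1 \<le> 2 * n\<close>.\<close>
      also have "\<dots> = D * 2 powr \<gamma> * (2 * n) powr - \<gamma>"
        using n by (simp add: powr_mult powr_minus)
      also have "\<dots> \<le> D * 2 powr \<gamma> * (n + 1) powr - \<gamma>"
        using n \<gamma> \<open>0 \<le> D\<close> by (intro mult_left_mono powr_mono2') simp_all
      also have "\<dots> \<le> Q * (n + 1) powr - \<gamma>"
        using Q(2) by (intro mult_right_mono) simp_all
      finally show ?thesis .
    qed
    then show ?case by (simp add: n_def add_ac)
  qed
  then show ?thesis by blast
qed

section \<open>Bias and second moment of the kernel estimate\<close>

context sqg_problem
begin

section \<open>Bounds on the density and the kernel\<close>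

lemma g_bounds:
  assumes "y \<in> X"
  shows "0 \<le> g y" "g y \<le> gbar"
  using g_class assms unfolding density_class_def by force+

lemma envelope_at_x: "0 \<le> glo x" "glo x \<le> g x" "g x \<le> ghi x" "ghi x \<le> gbar"
  using g_class x_in_X unfolding density_class_def by auto

lemma gbar_nonneg: "0 \<le> gbar"
  using g_bounds[OF x_in_X] by simp

lemma Kbar_nonneg: "0 \<le> Kbar"
  using K_nonneg[of x] K_bounded[OF x_in_X] by simp

text \<open>The Bochner integral of a non-integrable function is 0 by convention, so the value 1
  forces integrability.\<close>

lemma integrable_K: "integrable lborel K"
  using K_density not_integrable_integral_eq[of lborel K] by fastforce

text \<open>\<open>K\<close> is bounded only on \<open>X\<close>, but its mass on \<open>X\<close> is already its total mass, so it
  vanishes almost everywhere outside \<open>X\<close>.\<close>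

lemma AE_K_le: "AE y in lborel. K y \<le> Kbar"
proof -
  note [measurable] = X_borel K_borel
  have X: "integrable lborel (\<lambda>y. indicator X y * K y)"
    using integrable_real_mult_indicator[OF _ integrable_K, of X] X_borel by (simp add: mult.commute)
  have "(LINT y|lborel. K y - indicator X y * K y) = 0"
    using K_density K_density_X X integrable_K by (simp add: set_lebesgue_integral_def)
  moreover have "integrable lborel (\<lambda>y. K y - indicator X y * K y)"
    using X integrable_K by simp
  ultimately have "AE y in lborel. K y - indicator X y * K y = 0"
    by (subst (asm) integral_nonneg_eq_0_iff_AE) (auto simp: indicator_def K_nonneg)
  then show ?thesis
    by eventually_elim (use K_bounded Kbar_nonneg in \<open>auto simp: indicator_def split: if_splits\<close>)
qed

section \<open>The kernel rescaled around \<open>x\<close>\<close>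

lemma scaled_kernel_affine:
  "scaled_kernel K x s u = K (- (x /\<^sub>R s) + (1 / s) *\<^sub>R u) / s ^ CARD('n)"
  by (simp add: scaled_kernel_def inverse_eq_divide scaleR_diff_right)

lemma scaled_kernel_measurable [measurable]: "scaled_kernel K x s \<in> borel_measurable borel"
  using K_borel unfolding scaled_kernel_def[abs_def] by measurable

lemma scaled_kernel_nonneg: "0 < s \<Longrightarrow> 0 \<le> scaled_kernel K x s u"
  by (simp add: scaled_kernel_def K_nonneg)

lemma integrable_scaled_kernel:
  assumes "0 < s"
  shows "integrable lborel (scaled_kernel K x s)"
  unfolding scaled_kernel_affine[abs_def]
  using assms integrable_K K_borel
  by (intro integrable_divide integrable_lborel_affine_iff[THEN iffD2]) simp_all

lemma AE_scaled_kernel_le: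
  assumes "0 < s"
  shows "AE u in lborel. scaled_kernel K x s u \<le> Kbar / s ^ CARD('n)"
proof -
  note [measurable] = K_borel
  have "AE u in lborel. K (- (x /\<^sub>R s) + (1 / s) *\<^sub>R u) \<le> Kbar"
    using assms by (intro AE_lborel_affine[where P = "\<lambda>y. K y \<le> Kbar"] AE_K_le) simp_all
  then show ?thesis
    unfolding scaled_kernel_affine
    by eventually_elim (use assms in \<open>simp add: divide_right_mono\<close>)
qed

text \<open>Substitute \<open>y = (u - x) / s\<close>: the normalisation of the kernel cancels the
  Jacobian, and homogeneity of the norm leaves \<open>s powr \<nu>\<close>. This factor is the order
  of the bias.\<close>

lemma scaled_kernel_moment:
  assumes "0 < s"
  shows "integrable lborel (\<lambda>u. norm (x - u) powr \<nu> * scaled_kernel K x s u)"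
    and "(LINT u|lborel. norm (x - u) powr \<nu> * scaled_kernel K x s u)
         = s powr \<nu> * (LINT y|lborel. norm y powr \<nu> * K y)"
proof -
  note [measurable] = K_borel
  define f where "f y = norm y powr \<nu> * K y" for y :: "real ^ 'n"
  have [measurable]: "f \<in> borel_measurable borel"
    unfolding f_def by measurable
  have eq: "norm (x - u) powr \<nu> * scaled_kernel K x s u
      = s powr \<nu> / s ^ CARD('n) * f (- (x /\<^sub>R s) + (1 / s) *\<^sub>R u)" for u
  proof -
    have "- (x /\<^sub>R s) + (1 / s) *\<^sub>R u = (u - x) /\<^sub>R s"
      by (simp add: inverse_eq_divide scaleR_diff_right)
    moreover have "norm (x - u) = s * norm ((u - x) /\<^sub>R s)"
      unfolding norm_scaleR using assms by (simp add: norm_minus_commute)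
    then have "norm (x - u) powr \<nu> = s powr \<nu> * norm ((u - x) /\<^sub>R s) powr \<nu>"
      using assms by (simp only: powr_mult)
    ultimately show ?thesis
      by (simp add: scaled_kernel_def f_def)
  qed
  have "integrable lborel f"
    using K_moment by (simp add: f_def[abs_def])
  then show "integrable lborel (\<lambda>u. norm (x - u) powr \<nu> * scaled_kernel K x s u)"
    unfolding eq using assms
    by (intro integrable_mult_right integrable_lborel_affine_iff[THEN iffD2]) simp_all
  show "(LINT u|lborel. norm (x - u) powr \<nu> * scaled_kernel K x s u)
         = s powr \<nu> * (LINT y|lborel. norm y powr \<nu> * K y)"
    unfolding eq f_def[symmetric]
    using assms integral_lborel_affine[of "1 / s" f "- (x /\<^sub>R s)"] by (simp add: power_one_over)
qed

section \<open>Integration against the law of an observation\<close>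

lemma weight_measurable [measurable]: "(\<lambda>y. indicator X y * g y) \<in> borel_measurable borel"
  using g_measurable by (simp add: set_borel_measurable_def)

lemma obs_measurable [measurable]: "obs t \<in> M \<rightarrow>\<^sub>M borel"
  using distributed_measurable[OF obs_density[of t]] by simp

lemma weight_nonneg: "0 \<le> indicator X y * g y"
  using g_bounds by (simp add: indicator_def)

lemma weight_le: "indicator X y * g y \<le> gbar * indicator X y"
  using g_bounds by (simp add: indicator_def)

lemma expectation_obs:
  assumes [measurable]: "f \<in> borel_measurable borel"
  shows "expectation (\<lambda>w. f (obs t w)) = (LINT u|lborel. indicator X u * g u * f u)"
    and "integrable M (\<lambda>w. f (obs t w)) \<longleftrightarrow> integrable lborel (\<lambda>u. indicator X u * g u * f u)"
  using distributed_integral[OF obs_density, of f t] distributed_integrable[OF obs_density, of f t]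
    weight_nonneg by simp_all

lemma integrable_window:
  assumes "0 < s"
  shows "integrable lborel (\<lambda>u. indicator X u * scaled_kernel K x s u)"
  using integrable_real_mult_indicator[OF _ integrable_scaled_kernel[OF assms], of X] X_borel
  by (simp add: mult.commute)

lemma scaled_kernel_obs_integrable:
  assumes "0 < s"
  shows "integrable M (\<lambda>w. scaled_kernel K x s (obs t w))"
proof (subst expectation_obs(2))
  note [measurable] = X_borel
  show "integrable lborel (\<lambda>u. indicator X u * g u * scaled_kernel K x s u)"
  proof (rule Bochner_Integration.integrable_bound)
    show "integrable lborel (\<lambda>u. gbar * scaled_kernel K x s u)"
      using integrable_scaled_kernel[OF assms] by simp
    show "AE u in lborel. norm (indicator X u * g u * scaled_kernel K x s u)
        \<le> norm (gbar * scaled_kernel K x s u)"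
      using g_bounds gbar_nonneg scaled_kernel_nonneg[OF assms]
      by (intro AE_I2) (simp add: indicator_def abs_mult mult_right_mono)
  qed simp
qed simp

text \<open>By \<open>window\<close>, \<open>g x\<close> is the integral of \<open>g x\<close> times
  the rescaled kernel over \<open>X\<close>. The bias is thus the integral of
  \<open>g u - g x\<close> against that kernel, where the Holder bound and the moment formula apply.
  The absolute value of \<open>H\<close> makes the dominating function nonnegative outside
  \<open>X\<close> as well.\<close>

lemma scaled_kernel_obs_bias:
  assumes s: "s \<in> {0<..\<theta>}"
  shows "\<bar>expectation (\<lambda>w. scaled_kernel K x s (obs t w)) - g x\<bar>
         \<le> \<bar>H\<bar> * s powr \<nu> * (LINT y|lborel. norm y powr \<nu> * K y)"
proof -
  note [measurable] = X_borel
  have "0 < s" using s by simp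
  note int = integrable_window[OF this] scaled_kernel_obs_integrable[OF this, of t, unfolded expectation_obs(2)[OF scaled_kernel_measurable]]
  have "expectation (\<lambda>w. scaled_kernel K x s (obs t w)) - g x
      = (LINT u|lborel. indicator X u * g u * scaled_kernel K x s u)
        - g x * (LINT u|lborel. indicator X u * scaled_kernel K x s u)"
    using window[OF s] by (simp add: expectation_obs set_lebesgue_integral_def)
  also have "\<dots> = (LINT u|lborel. indicator X u * g u * scaled_kernel K x s u
        - g x * (indicator X u * scaled_kernel K x s u))"
    using int by simp
  also have "\<bar>\<dots>\<bar> \<le> (LINT u|lborel. \<bar>H\<bar> * (norm (x - u) powr \<nu> * scaled_kernel K x s u))"
  proof (rule order_trans[OF integral_abs_bound integral_mono])
    show "integrable lborel (\<lambda>u. \<bar>indicator X u * g u * scaled_kernel K x s u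
        - g x * (indicator X u * scaled_kernel K x s u)\<bar>)"
      using int by (intro integrable_abs Bochner_Integration.integrable_diff) simp_all
    show "integrable lborel (\<lambda>u. \<bar>H\<bar> * (norm (x - u) powr \<nu> * scaled_kernel K x s u))"
      using scaled_kernel_moment(1)[OF \<open>0 < s\<close>] by simp
    fix u
    show "\<bar>indicator X u * g u * scaled_kernel K x s u - g x * (indicator X u * scaled_kernel K x s u)\<bar>
        \<le> \<bar>H\<bar> * (norm (x - u) powr \<nu> * scaled_kernel K x s u)"
    proof (cases "u \<in> X")
      case True
      have "\<bar>g u - g x\<bar> \<le> H * norm (x - u) powr \<nu>"
        using g_holder[OF True] by (simp add: abs_minus_commute)
      also have "\<dots> \<le> \<bar>H\<bar> * norm (x - u) powr \<nu>"
        by (intro mult_right_mono) simp_all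
      finally have "\<bar>g u - g x\<bar> * scaled_kernel K x s u
          \<le> \<bar>H\<bar> * norm (x - u) powr \<nu> * scaled_kernel K x s u"
        using scaled_kernel_nonneg[OF \<open>0 < s\<close>] by (intro mult_right_mono)
      moreover have "\<bar>g u * scaled_kernel K x s u - g x * scaled_kernel K x s u\<bar>
          = \<bar>g u - g x\<bar> * scaled_kernel K x s u"
        using scaled_kernel_nonneg[OF \<open>0 < s\<close>, of u]
        by (simp add: left_diff_distrib[symmetric] abs_mult)
      ultimately show ?thesis
        using True by simp
    next
      case False
      then show ?thesis using scaled_kernel_nonneg[OF \<open>0 < s\<close>, of u] by simp
    qed
  qed
  also have "\<dots> = \<bar>H\<bar> * s powr \<nu> * (LINT y|lborel. norm y powr \<nu> * K y)"
    using scaled_kernel_moment(2)[OF \<open>0 < s\<close>] by simp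
  finally show ?thesis .
qed

text \<open>Only one of the two kernel factors is replaced by its bound \<open>Kbar / s ^ r\<close>,
  with \<open>r = CARD('n)\<close>; the other integrates to 1 over \<open>X\<close> by
  \<open>window\<close>. Hence a single power \<open>s ^ r\<close> appears in the denominator, not
  its square.\<close>

lemma scaled_kernel_obs_second_moment:
  assumes s: "s \<in> {0<..\<theta>}"
  shows "integrable M (\<lambda>w. (scaled_kernel K x s (obs t w))\<^sup>2)"
    and "expectation (\<lambda>w. (scaled_kernel K x s (obs t w))\<^sup>2) \<le> gbar * Kbar / s ^ CARD('n)"
proof -
  note [measurable] = X_borel
  have "0 < s" using s by simp
  have bound: "AE u in lborel. indicator X u * g u * (scaled_kernel K x s u)\<^sup>2
      \<le> gbar * Kbar / s ^ CARD('n) * (indicator X u * scaled_kernel K x s u)"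
    using AE_scaled_kernel_le[OF \<open>0 < s\<close>]
  proof eventually_elim
    case (elim u)
    have "indicator X u * g u * (scaled_kernel K x s u)\<^sup>2
        \<le> gbar * indicator X u * (scaled_kernel K x s u)\<^sup>2"
      using weight_le by (intro mult_right_mono) simp_all
    also have "\<dots> = gbar * indicator X u * scaled_kernel K x s u * scaled_kernel K x s u"
      by (simp add: power2_eq_square)
    also have "\<dots> \<le> gbar * indicator X u * scaled_kernel K x s u * (Kbar / s ^ CARD('n))"
      using elim gbar_nonneg scaled_kernel_nonneg[OF \<open>0 < s\<close>] by (intro mult_left_mono) simp_all
    finally show ?case by (simp add: mult_ac)
  qed
  have int: "integrable lborel
      (\<lambda>u. gbar * Kbar / s ^ CARD('n) * (indicator X u * scaled_kernel K x s u))"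
    using integrable_window[OF \<open>0 < s\<close>] by simp
  have int2: "integrable lborel (\<lambda>u. indicator X u * g u * (scaled_kernel K x s u)\<^sup>2)"
  proof (rule Bochner_Integration.integrable_bound[OF int])
    show "AE u in lborel. norm (indicator X u * g u * (scaled_kernel K x s u)\<^sup>2)
      \<le> norm (gbar * Kbar / s ^ CARD('n) * (indicator X u * scaled_kernel K x s u))"
      using bound
    proof eventually_elim
      case (elim u)
      have "0 \<le> indicator X u * g u * (scaled_kernel K x s u)\<^sup>2"
        using weight_nonneg by simp
      then show ?case unfolding real_norm_def using elim by linarith
    qed
  qed simp
  then show "integrable M (\<lambda>w. (scaled_kernel K x s (obs t w))\<^sup>2)"
    by (subst expectation_obs(2)[where f = "\<lambda>u. (scaled_kernel K x s u)\<^sup>2"]) simp_all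
  have "expectation (\<lambda>w. (scaled_kernel K x s (obs t w))\<^sup>2)
      = (LINT u|lborel. indicator X u * g u * (scaled_kernel K x s u)\<^sup>2)"
    by (subst expectation_obs(1)[where f = "\<lambda>u. (scaled_kernel K x s u)\<^sup>2"]) simp_all
  also have "\<dots> \<le> (LINT u|lborel. gbar * Kbar / s ^ CARD('n) * (indicator X u * scaled_kernel K x s u))"
    by (rule integral_mono_AE[OF int2 int bound])
  also have "\<dots> = gbar * Kbar / s ^ CARD('n)"
    using window[OF s] by (simp add: set_lebesgue_integral_def)
  finally show "expectation (\<lambda>w. (scaled_kernel K x s (obs t w))\<^sup>2) \<le> gbar * Kbar / s ^ CARD('n)" .
qed

section \<open>The mean square error recursion\<close>

lemma sqg_range: "sqg (glo x) (ghi x) K x rho th obs z0 t w \<in> {glo x..ghi x}"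
  using z0_range envelope_at_x by (cases t) (auto simp: Let_def)

text \<open>Running the recursion on the vector \<open>v\<close> of past observations, with the
  coordinate maps as the observations, shows \<open>z t\<close> to be a function of the block before
  \<open>t\<close>, as independence of blocks requires.\<close>

lemma sqg_history:
  "sqg lo hi K x rho th obs z0 t w = sqg lo hi K x rho th (\<lambda>i v. v i) z0 t (\<lambda>i\<in>{..<t}. obs i w)"
proof -
  \<comment> \<open>The length \<open>m\<close> of the history is kept apart from \<open>t\<close>,
    so that the restricted vector stays the same throughout the induction.\<close>
  have "sqg lo hi K x rho th obs z0 t w = sqg lo hi K x rho th (\<lambda>i v. v i) z0 t (\<lambda>i\<in>{..<m}. obs i w)"
    if "t \<le> m" for m
    using that by (induction t) (simp_all add: Let_def)
  then show ?thesis by blast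
qed

text \<open>With \<open>m\<close> separate from \<open>t\<close>, all iterates up to time
  \<open>m\<close> live on one product space, and the induction never changes spaces.\<close>

lemma sqg_history_measurable:
  "t \<le> m \<Longrightarrow> sqg lo hi K x rho th (\<lambda>i v. v i) z0 t \<in> borel_measurable (PiM {..<m} (\<lambda>_. borel))"
proof (induction t)
  case 0
  have "sqg lo hi K x rho th (\<lambda>i v. v i) z0 0 = (\<lambda>_. z0)"
    by (simp add: fun_eq_iff)
  then show ?case by simp
next
  case (Suc t)
  have [measurable]: "(\<lambda>v. v t) \<in> PiM {..<m} (\<lambda>_. borel) \<rightarrow>\<^sub>M (borel :: (real ^ 'n) measure)"
    using Suc.prems by (intro measurable_component_singleton) simp
  note [measurable] = Suc.IH[OF Suc_leD[OF Suc.prems]]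
  have "sqg lo hi K x rho th (\<lambda>i v. v i) z0 (Suc t) = (\<lambda>v.
      let z = sqg lo hi K x rho th (\<lambda>i v. v i) z0 t v
      in min hi (max lo (z - rho t * (z - scaled_kernel K x (th t) (v t)))))"
    by (simp add: fun_eq_iff)
  then show ?case unfolding Let_def by simp
qed

lemma sqg_measurable [measurable]:
  "sqg lo hi K x rho th obs z0 t \<in> borel_measurable M"
  by (induction t) (simp_all add: Let_def)

text \<open>Functions of the disjoint blocks \<open>{..<t}\<close> and \<open>{t}\<close> of an
  independent family are independent.\<close>

lemma sqg_indep_obs:
  assumes [measurable]: "f \<in> borel_measurable borel"
  shows "indep_var borel (sqg lo hi K x rho th obs z0 t) borel (\<lambda>w. f (obs t w) :: real)"
proof -
  have "indep_var (PiM {..<t} (\<lambda>_. borel)) (\<lambda>w. \<lambda>i\<in>{..<t}. obs i w)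
      (PiM {t} (\<lambda>_. borel)) (\<lambda>w. \<lambda>i\<in>{t}. obs i w)"
    by (rule indep_var_restrict[OF obs_indep]) auto
  from indep_var_compose[OF this sqg_history_measurable[OF order_refl, of lo hi rho th]
      measurable_compose[OF measurable_component_singleton[of t "{t}" "\<lambda>_. borel"] assms]]
  have "indep_var borel
      (sqg lo hi K x rho th (\<lambda>i v. v i) z0 t \<circ> (\<lambda>w. \<lambda>i\<in>{..<t}. obs i w))
      borel ((\<lambda>v. f (v t)) \<circ> (\<lambda>w. \<lambda>i\<in>{t}. obs i w))"
    by simp
  moreover have "sqg lo hi K x rho th (\<lambda>i v. v i) z0 t \<circ> (\<lambda>w. \<lambda>i\<in>{..<t}. obs i w)
      = sqg lo hi K x rho th obs z0 t"
    using sqg_history by (auto simp: fun_eq_iff)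
  moreover have "(\<lambda>v. f (v t)) \<circ> (\<lambda>w. \<lambda>i\<in>{t}. obs i w) = (\<lambda>w. f (obs t w))"
    by (auto simp: fun_eq_iff)
  ultimately show ?thesis by simp
qed

lemma sqg_error_le: "\<bar>sqg (glo x) (ghi x) K x rho th obs z0 t w - g x\<bar> \<le> gbar"
  using sqg_range[of rho th t w] envelope_at_x by auto

lemma sqg_mse_step:
  fixes rho th :: "nat \<Rightarrow> real"
  defines "z \<equiv> sqg (glo x) (ghi x) K x rho th obs z0"
  assumes rho: "0 \<le> rho t" and th: "th t \<in> {0<..\<theta>}"
  shows "expectation (\<lambda>w. (z (Suc t) w - g x)\<^sup>2)
    \<le> (1 - 2 * rho t) * expectation (\<lambda>w. (z t w - g x)\<^sup>2)
      + 2 * rho t * (gbar * (\<bar>H\<bar> * th t powr \<nu> * (LINT y|lborel. norm y powr \<nu> * K y)))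
      + (rho t)\<^sup>2 * (gbar\<^sup>2 + gbar * Kbar / th t ^ CARD('n))"
proof -
  define k where "k w = scaled_kernel K x (th t) (obs t w)" for w
  define e where "e w = z t w - g x" for w
  have "0 < th t" using th by simp
  have e_le: "\<bar>e w\<bar> \<le> gbar" for w
    using sqg_error_le by (simp add: e_def z_def)
  have [measurable]: "z t \<in> borel_measurable M" "z (Suc t) \<in> borel_measurable M"
    unfolding z_def by (rule sqg_measurable)+
  have [measurable]: "e \<in> borel_measurable M" "k \<in> borel_measurable M"
    unfolding e_def k_def by measurable
  have int_e: "integrable M e"
    using e_le by (intro integrable_const_bound[where B = gbar]) simp_all
  have int_e2: "integrable M (\<lambda>w. (e w)\<^sup>2)"
    using power_mono[OF e_le, of _ 2] by (intro integrable_const_bound[where B = "gbar\<^sup>2"]) simp_all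
  have int_k: "integrable M k"
    using scaled_kernel_obs_integrable[OF \<open>0 < th t\<close>] by (simp add: k_def[abs_def])
  have int_k2: "integrable M (\<lambda>w. (k w)\<^sup>2)"
    using scaled_kernel_obs_second_moment(1)[OF th] by (simp add: k_def)
  have "indep_var borel ((\<lambda>y. y - g x) \<circ> z t) borel ((\<lambda>y. y) \<circ> k)"
    unfolding z_def k_def[abs_def]
    by (rule indep_var_compose[OF sqg_indep_obs[OF scaled_kernel_measurable]]) simp_all
  then have indep: "indep_var borel e borel k"
    by (simp add: e_def[abs_def] o_def)
  \<comment> \<open>Independence factorises the cross term, so the kernel enters it only through its
    mean, that is, through the bias.\<close>
  have int_ek: "integrable M (\<lambda>w. e w * k w)"
    and E_ek: "expectation (\<lambda>w. e w * k w) = expectation e * expectation k"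
    using indep_var_integrable[OF indep int_e int_k] indep_var_lebesgue_integral[OF indep int_e int_k]
    by simp_all
  have pointwise: "(z (Suc t) w - g x)\<^sup>2
      \<le> (1 - 2 * rho t) * (e w)\<^sup>2 + 2 * rho t * (e w * k w - g x * e w)
        + (rho t)\<^sup>2 * (gbar\<^sup>2 + (k w)\<^sup>2)" for w
  proof -
    define y where "y = z t w - rho t * (z t w - k w)"
    have "z (Suc t) w = min (ghi x) (max (glo x) y)"
      by (simp add: z_def y_def k_def Let_def)
    then have "\<bar>z (Suc t) w - g x\<bar> \<le> \<bar>y - g x\<bar>"
      using envelope_at_x by auto
    then have "(z (Suc t) w - g x)\<^sup>2 \<le> (y - g x)\<^sup>2"
      by (simp add: abs_le_square_iff)
    \<comment> \<open>Here \<open>y - g x = e w - rho t * (z t w - k w)\<close> and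
      \<open>z t w - k w = e w - (k w - g x)\<close>; the product of \<open>e w\<close> with the
      latter yields the contraction and the cross term.\<close>
    also have "\<dots> = (1 - 2 * rho t) * (e w)\<^sup>2 + 2 * rho t * (e w * k w - g x * e w)
        + (rho t)\<^sup>2 * (z t w - k w)\<^sup>2"
      by (simp add: y_def e_def power2_eq_square algebra_simps)
    also have "\<dots> \<le> (1 - 2 * rho t) * (e w)\<^sup>2 + 2 * rho t * (e w * k w - g x * e w)
        + (rho t)\<^sup>2 * (gbar\<^sup>2 + (k w)\<^sup>2)"
    proof -
      have z: "0 \<le> z t w" "z t w \<le> gbar"
        using sqg_range[of rho th t w] envelope_at_x by (auto simp: z_def)
      have "0 \<le> k w"
        using scaled_kernel_nonneg[OF \<open>0 < th t\<close>] by (simp add: k_def)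
      \<comment> \<open>Iterate and kernel value are nonnegative, so the mixed term of the square
        only helps.\<close>
      then have "(z t w - k w)\<^sup>2 \<le> (z t w)\<^sup>2 + (k w)\<^sup>2"
        using z(1) by (simp add: power2_diff)
      also have "(z t w)\<^sup>2 \<le> gbar\<^sup>2"
        using z by (intro power_mono)
      finally show ?thesis
        by (intro add_left_mono mult_left_mono) simp_all
    qed
    finally show ?thesis .
  qed
  have "expectation (\<lambda>w. (z (Suc t) w - g x)\<^sup>2)
      \<le> expectation (\<lambda>w. (1 - 2 * rho t) * (e w)\<^sup>2 + 2 * rho t * (e w * k w - g x * e w)
        + (rho t)\<^sup>2 * (gbar\<^sup>2 + (k w)\<^sup>2))"
  proof (rule integral_mono[OF _ _ pointwise])
    have "\<bar>z (Suc t) w - g x\<bar>\<^sup>2 \<le> gbar\<^sup>2" for w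
      unfolding z_def by (rule power_mono[OF sqg_error_le]) simp
    then show "integrable M (\<lambda>w. (z (Suc t) w - g x)\<^sup>2)"
      by (intro integrable_const_bound[where B = "gbar\<^sup>2"]) simp_all
  qed (use int_e int_e2 int_k2 int_ek in simp)
  also have "\<dots> = (1 - 2 * rho t) * expectation (\<lambda>w. (e w)\<^sup>2)
      + 2 * rho t * (expectation e * (expectation k - g x))
      + (rho t)\<^sup>2 * (gbar\<^sup>2 + expectation (\<lambda>w. (k w)\<^sup>2))"
    using int_e int_e2 int_k2 int_ek by (simp add: E_ek prob_space) (simp add: algebra_simps)
  also have "\<dots> \<le> (1 - 2 * rho t) * expectation (\<lambda>w. (e w)\<^sup>2)
      + 2 * rho t * (gbar * (\<bar>H\<bar> * th t powr \<nu> * (LINT y|lborel. norm y powr \<nu> * K y)))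
      + (rho t)\<^sup>2 * (gbar\<^sup>2 + gbar * Kbar / th t ^ CARD('n))"
  proof (intro add_mono order_refl mult_left_mono)
    have "\<bar>expectation e\<bar> \<le> expectation (\<lambda>w. \<bar>e w\<bar>)"
      by (rule integral_abs_bound)
    also have "\<dots> \<le> expectation (\<lambda>w. gbar)"
      using int_e e_le by (intro integral_mono) simp_all
    finally have "\<bar>expectation e\<bar> \<le> gbar"
      by (simp add: prob_space)
    moreover have "\<bar>expectation k - g x\<bar> \<le> \<bar>H\<bar> * th t powr \<nu> * (LINT y|lborel. norm y powr \<nu> * K y)"
      using scaled_kernel_obs_bias[OF th, of t] by (simp add: k_def[abs_def])
    ultimately have "\<bar>expectation e * (expectation k - g x)\<bar>
        \<le> gbar * (\<bar>H\<bar> * th t powr \<nu> * (LINT y|lborel. norm y powr \<nu> * K y))"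
      unfolding abs_mult using gbar_nonneg by (intro mult_mono) simp_all
    then show "expectation e * (expectation k - g x)
        \<le> gbar * (\<bar>H\<bar> * th t powr \<nu> * (LINT y|lborel. norm y powr \<nu> * K y))"
      by linarith
    show "expectation (\<lambda>w. (k w)\<^sup>2) \<le> gbar * Kbar / th t ^ CARD('n)"
      using scaled_kernel_obs_second_moment(2)[OF th] by (simp add: k_def)
  qed (use rho in simp_all)
  finally show ?thesis by (simp add: e_def)
qed

text \<open>For a nonnegative exponent the one-step bound has the form that
  \<open>chung_recursion\<close> treats; its condition \<open>\<gamma> < 2 * \<rho>\<close> follows
  from \<open>\<gamma> \<le> p < \<rho>\<close>. A negative exponent is settled by boundedness
  alone.\<close>

lemma sqg_mse_bigo:
  assumes adm: "admissible \<rho> p q"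
  shows "sqg_mse M glo ghi g x K obs z0 \<theta> \<rho> p q
    \<in> O(\<lambda>t. 1 / (1 + real t) powr rate_exponent CARD('n) \<nu> p q)"
proof -
  define u where "u = sqg_mse M glo ghi g x K obs z0 \<theta> \<rho> p q"
  define \<gamma> where "\<gamma> = rate_exponent CARD('n) \<nu> p q"
  have q: "0 \<le> q" and p: "0 < p" "p \<le> 1" "p < \<rho>"
    using adm by (auto simp: admissible_def)
  have \<gamma>: "\<gamma> \<le> \<nu> * q" "\<gamma> \<le> p" "\<gamma> \<le> p - real CARD('n) * q"
    by (auto simp: \<gamma>_def rate_exponent_def)
  have u_nonneg: "0 \<le> u t" for t
    by (simp add: u_def sqg_mse_def)
  have "\<exists>Q. \<forall>t. u t \<le> Q * (1 + real t) powr - \<gamma>"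
  proof (cases "0 \<le> \<gamma>")
    case True
    define A where "A = (LINT y|lborel. norm y powr \<nu> * K y)"
    \<comment> \<open>The coefficients of the bias, of the squared iterate and of the second moment
      of the kernel, with the powers of \<open>1 + t\<close> split off.\<close>
    define B C E where "B = 2 * \<rho> * (gbar * (\<bar>H\<bar> * \<theta> powr \<nu> * A))"
      and "C = \<rho>\<^sup>2 * gbar\<^sup>2" and "E = \<rho>\<^sup>2 * (gbar * Kbar / \<theta> ^ CARD('n))"
    have "0 \<le> A"
      unfolding A_def using K_nonneg by (intro Bochner_Integration.integral_nonneg) simp
    then have nonneg: "0 \<le> B" "0 \<le> C" "0 \<le> E"
      using p gbar_nonneg Kbar_nonneg theta_pos by (simp_all add: B_def C_def E_def)
    show ?thesis
    proof (rule chung_recursion[where D = "B + C + E" and p = p and \<rho> = \<rho>])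
      fix t
      define n where "n = 1 + real t"
      have n: "1 \<le> n" by (simp add: n_def)
      have rho: "stepsize \<rho> p t = \<rho> * n powr - p"
        and th: "bandwidth \<theta> q t = \<theta> * n powr - q"
        by (simp_all add: stepsize_def bandwidth_def n_def powr_minus divide_inverse)
      \<comment> \<open>Since \<open>q \<ge> 0\<close>, every bandwidth stays in the range for which
        \<open>window\<close> is assumed.\<close>
      have "n powr - q \<le> n powr 0"
        using n q by (intro powr_mono) simp_all
      then have th_mem: "bandwidth \<theta> q t \<in> {0<..\<theta>}"
        using theta_pos n mult_left_mono[of "n powr - q" 1 \<theta>] by (simp add: th)
      have "u (Suc t) \<le> (1 - 2 * stepsize \<rho> p t) * u t
          + 2 * stepsize \<rho> p t * (gbar * (\<bar>H\<bar> * bandwidth \<theta> q t powr \<nu> * A))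
          + (stepsize \<rho> p t)\<^sup>2 * (gbar\<^sup>2 + gbar * Kbar / bandwidth \<theta> q t ^ CARD('n))"
        using sqg_mse_step[of "stepsize \<rho> p" t "bandwidth \<theta> q", OF _ th_mem] p n
        by (simp add: u_def sqg_mse_def A_def rho)
      also have "2 * stepsize \<rho> p t * (gbar * (\<bar>H\<bar> * bandwidth \<theta> q t powr \<nu> * A))
          = B * n powr (- p - \<nu> * q)"
      proof -
        have "bandwidth \<theta> q t powr \<nu> = \<theta> powr \<nu> * n powr (- (\<nu> * q))"
          using theta_pos n by (simp add: th powr_mult powr_powr mult.commute)
        moreover have "n powr (- p - \<nu> * q) = n powr - p * n powr (- (\<nu> * q))"
          by (simp add: powr_add[symmetric] algebra_simps)
        ultimately show ?thesis by (simp add: rho B_def)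
      qed
      also have "(stepsize \<rho> p t)\<^sup>2 * (gbar\<^sup>2 + gbar * Kbar / bandwidth \<theta> q t ^ CARD('n))
          = C * n powr (- p - p) + E * n powr (- p - (p - real CARD('n) * q))"
      proof -
        have "(n powr - p)\<^sup>2 = n powr (- p - p)"
          using n by (simp add: power2_eq_square powr_add[symmetric])
        moreover have "bandwidth \<theta> q t ^ CARD('n) = \<theta> ^ CARD('n) * n powr (- (real CARD('n) * q))"
          using n by (simp add: th power_mult_distrib powr_realpow[symmetric] powr_powr mult.commute)
        moreover have "n powr (- p - (p - real CARD('n) * q))
            = n powr (- p - p) / n powr (- (real CARD('n) * q))"
          by (simp add: powr_diff[symmetric])
        ultimately show ?thesis
          by (simp add: rho C_def E_def power_mult_distrib algebra_simps)
      qed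
      \<comment> \<open>As \<open>n \<ge> 1\<close>, each of the three powers is at most the one
        with exponent \<open>- p - \<gamma>\<close>, because \<open>\<gamma>\<close> is the least of
        \<open>\<nu> * q\<close>, \<open>p\<close> and \<open>p - r * q\<close>.\<close>
      also have "(1 - 2 * stepsize \<rho> p t) * u t + B * n powr (- p - \<nu> * q)
            + (C * n powr (- p - p) + E * n powr (- p - (p - real CARD('n) * q)))
          \<le> (1 - 2 * stepsize \<rho> p t) * u t + B * n powr (- p - \<gamma>)
            + (C * n powr (- p - \<gamma>) + E * n powr (- p - \<gamma>))"
        using nonneg n \<gamma> by (intro add_mono order_refl mult_left_mono powr_mono) simp_all
      finally show "u (Suc t) \<le> (1 - 2 * (\<rho> / (1 + real t) powr p)) * u t
          + (B + C + E) * (1 + real t) powr (- p - \<gamma>)"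
        by (simp add: n_def stepsize_def algebra_simps)
    qed (use nonneg p True \<gamma> u_nonneg in auto)
  next
    \<comment> \<open>The bandwidth shrinks so fast that \<open>p < r * q\<close>. The comparison
      function is then at least 1, and the error never exceeds \<open>gbar\<close>.\<close>
    case False
    have "u t \<le> gbar\<^sup>2 * (1 + real t) powr - \<gamma>" for t
    proof -
      have "(\<bar>sqg (glo x) (ghi x) K x (stepsize \<rho> p) (bandwidth \<theta> q) obs z0 t w - g x\<bar>)\<^sup>2 \<le> gbar\<^sup>2"
        for w
        by (rule power_mono[OF sqg_error_le]) simp
      then have "u t \<le> expectation (\<lambda>w. gbar\<^sup>2)"
        unfolding u_def sqg_mse_def
        by (intro integral_mono integrable_const_bound[where B = "gbar\<^sup>2"]) simp_all
      also have "\<dots> = gbar\<^sup>2 * 1"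
        by (simp add: prob_space)
      also have "\<dots> \<le> gbar\<^sup>2 * (1 + real t) powr - \<gamma>"
        using False by (intro mult_left_mono ge_one_powr_ge_zero) simp_all
      finally show ?thesis .
    qed
    then show ?thesis by blast
  qed
  then obtain Q where "u t \<le> Q * (1 + real t) powr - \<gamma>" for t
    by blast
  then have "\<bar>u t\<bar> \<le> Q * \<bar>1 / (1 + real t) powr \<gamma>\<bar>" for t
    using u_nonneg[of t] by (simp add: powr_minus divide_inverse)
  then have "u \<in> O(\<lambda>t. 1 / (1 + real t) powr \<gamma>)"
    by (intro bigoI[of _ Q] always_eventually) simp
  then show ?thesis by (simp add: u_def \<gamma>_def)
qed

end

section \<open>Maximising the exponent\<close>

text \<open>This \<open>q\<close> solves \<open>\<nu> * q = 1 - r * q\<close>: bias and second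
  moment are in balance, and their common exponent is at most \<open>p = 1\<close>.\<close>

lemma rate_exponent_optimum:
  assumes "0 < \<nu>"
  shows "rate_exponent r \<nu> 1 (1 / (real r + \<nu>)) = \<nu> / (real r + \<nu>)"
proof -
  have "1 - real r * (1 / (real r + \<nu>)) = \<nu> / (real r + \<nu>)" "\<nu> / (real r + \<nu>) \<le> 1"
    using assms by (simp_all add: field_simps)
  then show ?thesis by (simp add: rate_exponent_def)
qed

text \<open>The bound is the convex combination of \<open>\<nu> * q\<close> and \<open>p - r * q\<close> with weights
  \<open>r / (r + \<nu>)\<close> and \<open>\<nu> / (r + \<nu>)\<close>, in which \<open>q\<close> cancels.\<close>

lemma rate_exponent_le:
  assumes "0 < \<nu>" "p \<le> 1"
  shows "rate_exponent r \<nu> p q \<le> \<nu> / (real r + \<nu>)"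
proof -
  let ?\<gamma> = "rate_exponent r \<nu> p q"
  have "real r * ?\<gamma> \<le> real r * (\<nu> * q)" "\<nu> * ?\<gamma> \<le> \<nu> * (p - real r * q)"
    using assms by (auto simp: rate_exponent_def intro!: mult_left_mono)
  then have "?\<gamma> * (real r + \<nu>) \<le> \<nu> * p"
    by (simp add: algebra_simps)
  also have "\<dots> \<le> \<nu>"
    using assms by simp
  finally show ?thesis
    using assms by (simp add: pos_le_divide_eq)
qed

text \<open>What is maximised is the exponent granted by the upper estimate of the error. The triple
  includes \<open>\<rho>\<close> because admissibility couples it to \<open>p\<close> by
  \<open>p < \<rho>\<close>; at \<open>p = 1\<close> this reads \<open>1 < \<rho>\<close>.\<close>

lemma is_arg_max_rate_exponent:
  assumes "0 < \<nu>" "1 < \<rho>"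
  shows "is_arg_max (\<lambda>(\<rho>', p, q). rate_exponent r \<nu> p q)
    (\<lambda>(\<rho>', p, q). admissible \<rho>' p q) (\<rho>, 1, 1 / (real r + \<nu>))"
  using assms rate_exponent_le[OF assms(1)] rate_exponent_optimum[OF assms(1), of r]
  by (auto simp: is_arg_max_def admissible_def not_less)

theorem corollary1:
  fixes M :: "'b measure" and X :: "(real ^ 'n) set"
    and glo ghi g K :: "real ^ 'n \<Rightarrow> real" and x :: "real ^ 'n"
    and obs :: "nat \<Rightarrow> 'b \<Rightarrow> real ^ 'n"
    and gbar H \<nu> Kbar z0 \<theta> :: real
  assumes "sqg_problem M X glo ghi gbar g x H \<nu> K Kbar obs z0 \<theta>"
  shows
    "(\<forall>\<rho> p q. admissible \<rho> p q \<longrightarrow>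
        sqg_mse M glo ghi g x K obs z0 \<theta> \<rho> p q
          \<in> O(\<lambda>t. 1 / (1 + real t) powr rate_exponent CARD('n) \<nu> p q))
     \<and> (\<forall>\<rho>>1. is_arg_max (\<lambda>(\<rho>', p, q). rate_exponent CARD('n) \<nu> p q)
                 (\<lambda>(\<rho>', p, q). admissible \<rho>' p q) (\<rho>, 1, 1 / (real CARD('n) + \<nu>)))
     \<and> rate_exponent CARD('n) \<nu> 1 (1 / (real CARD('n) + \<nu>)) = \<nu> / (real CARD('n) + \<nu>)
     \<and> (\<forall>\<rho>>1. sqg_mse M glo ghi g x K obs z0 \<theta> \<rho> 1 (1 / (real CARD('n) + \<nu>))
                 \<in> O(\<lambda>t. 1 / (1 + real t) powr (\<nu> / (real CARD('n) + \<nu>))))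
     \<and> (\<nu> = 1 \<and> CARD('n) = 1 \<longrightarrow>
          (\<forall>\<rho>>1. is_arg_max (\<lambda>(\<rho>', p, q). rate_exponent 1 1 p q)
                      (\<lambda>(\<rho>', p, q). admissible \<rho>' p q) (\<rho>, 1, 1 / 2)) \<and>
          rate_exponent 1 1 1 (1 / 2) = 1 / 2 \<and>
          (\<forall>\<rho>>1. sqg_mse M glo ghi g x K obs z0 \<theta> \<rho> 1 (1 / 2)
                      \<in> O(\<lambda>t. 1 / (1 + real t) powr (1 / 2))))"
proof -
  interpret sqg_problem M X glo ghi gbar g x H \<nu> K Kbar obs z0 \<theta>
    by (rule assms)
  let ?r = "real CARD('n)"
  note opt = rate_exponent_optimum[OF holder_exponent, of "CARD('n)"]
  have rate: "sqg_mse M glo ghi g x K obs z0 \<theta> \<rho> 1 (1 / (?r + \<nu>))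
      \<in> O(\<lambda>t. 1 / (1 + real t) powr (\<nu> / (?r + \<nu>)))" if "1 < \<rho>" for \<rho>
    using sqg_mse_bigo[of \<rho> 1 "1 / (?r + \<nu>)"] that holder_exponent
    unfolding opt by (simp add: admissible_def)
  show ?thesis
  proof (intro conjI allI impI; (elim conjE)?)
    fix \<rho> p q assume "admissible \<rho> p q"
    then show "sqg_mse M glo ghi g x K obs z0 \<theta> \<rho> p q
        \<in> O(\<lambda>t. 1 / (1 + real t) powr rate_exponent CARD('n) \<nu> p q)"
      by (rule sqg_mse_bigo)
  next
    fix \<rho> :: real assume "1 < \<rho>"
    then show "is_arg_max (\<lambda>(\<rho>', p, q). rate_exponent CARD('n) \<nu> p q)
        (\<lambda>(\<rho>', p, q). admissible \<rho>' p q) (\<rho>, 1, 1 / (?r + \<nu>))"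
      by (rule is_arg_max_rate_exponent[OF holder_exponent])
    show "sqg_mse M glo ghi g x K obs z0 \<theta> \<rho> 1 (1 / (?r + \<nu>))
        \<in> O(\<lambda>t. 1 / (1 + real t) powr (\<nu> / (?r + \<nu>)))"
      using \<open>1 < \<rho>\<close> by (rule rate)
  next
    show "rate_exponent CARD('n) \<nu> 1 (1 / (?r + \<nu>)) = \<nu> / (?r + \<nu>)"
      by (rule opt)
  next
    fix \<rho> :: real assume "1 < \<rho>"
    then show "is_arg_max (\<lambda>(\<rho>', p, q). rate_exponent 1 1 p q)
        (\<lambda>(\<rho>', p, q). admissible \<rho>' p q) (\<rho>, 1, 1 / 2)"
      using is_arg_max_rate_exponent[of 1 \<rho> 1] by simp
    assume "\<nu> = 1" "CARD('n) = 1"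
    then show "sqg_mse M glo ghi g x K obs z0 \<theta> \<rho> 1 (1 / 2)
        \<in> O(\<lambda>t. 1 / (1 + real t) powr (1 / 2))"
      using rate[OF \<open>1 < \<rho>\<close>] by simp
  next
    show "rate_exponent 1 1 1 (1 / 2) = 1 / 2"
      using rate_exponent_optimum[of 1 1] by simp
  qed
qed

end
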